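(* Let $R$ be a commutative ring with identity, let $S$ be a multiplicative subset of $R$, and let $0\longrightarrow P\stackrel{f}{\longrightarrow}N\stackrel{g}{\longrightarrow} M\longrightarrow 0$ be an exact sequence of $R$-modules. The following assertions hold: 1. If $P$ is $S$-finite and $N$ is $S$-coherent, then $M$ is $S$-coherent. 2. If $M$ and $P$ are $S$-coherent, then so is $N$. In particular, every finite direct sum of $S$-coherent modules is $S$-coherent. 3. If $N$ is $S$-coherent and $P$ is finitely generated, then $P$ is $S$-coherent.
   Context: All rings are commutative with identity and all modules are unitary. A multiplicative subset of $R$ is a subset containing $1$ and closed under multiplication. An $R$-module $M$ is $S$-finite if there exist a finitely generated submodule $N$ of $M$ and $s\in S$ such that $sM\subseteq N$. An $R$-module $M$ is $S$-finitely presented if there exists an exact sequence of $R$-modules $0\to K\to F\to M\to 0$ with $K$ an $S$-finite module and $F$ a finitely generated free module. An $R$-module $M$ is $S$-coherent if it is finitely generated and every finitely generated submodule of $M$ is $S$-finitely presented. *)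

theory Defs
  imports "Jordan_Normal_Form.Missing_VectorSpace"
begin

text \<open>
  Modules are those of \<open>HOL-Algebra\<close> (the ring \<open>R\<close> and the module are records with explicit
  carriers).  Homomorphisms, submodules, spans and linear independence are the ones of
  \<open>VectorSpace.LinearCombinations\<close>; in particular \<open>submodule R N M\<close> refers to that theory.
  A submodule \<open>N\<close> of \<open>M\<close> is regarded as a module in its own right via \<open>M\<lparr>carrier := N\<rparr>\<close>.
\<close>

definition finitely_generated ::
  "('r, 'z) ring_scheme \<Rightarrow> ('r, 'm, 'x) module_scheme \<Rightarrow> bool"
  where "finitely_generated R M \<longleftrightarrow> module R M \<and>
    (\<exists>A. finite A \<and> A \<subseteq> carrier M \<and> module.span R M A = carrier M)"

definition free_module ::
  "('r, 'z) ring_scheme \<Rightarrow> ('r, 'm, 'x) module_scheme \<Rightarrow> bool"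
  where "free_module R M \<longleftrightarrow> module R M \<and>
    (\<exists>B. B \<subseteq> carrier M \<and> \<not> module.lin_dep R M B \<and> module.span R M B = carrier M)"

definition short_exact ::
  "('r, 'z) ring_scheme \<Rightarrow> ('r, 'p, 'x) module_scheme \<Rightarrow> ('r, 'n, 'y) module_scheme \<Rightarrow>
   ('r, 'm, 'w) module_scheme \<Rightarrow> ('p \<Rightarrow> 'n) \<Rightarrow> ('n \<Rightarrow> 'm) \<Rightarrow> bool"
  where "short_exact R P N M f g \<longleftrightarrow>
    mod_hom R P N f \<and> mod_hom R N M g \<and>
    mod_hom.ker P N f = {\<zero>\<^bsub>P\<^esub>} \<and>
    mod_hom.im P f = mod_hom.ker N M g \<and>
    mod_hom.im N g = carrier M"

definition S_finite ::
  "('r, 'z) ring_scheme \<Rightarrow> 'r set \<Rightarrow> ('r, 'm, 'x) module_scheme \<Rightarrow> bool"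
  where "S_finite R S M \<longleftrightarrow> module R M \<and>
    (\<exists>N s. submodule R N M \<and> finitely_generated R (M\<lparr>carrier := N\<rparr>) \<and>
           s \<in> S \<and> (\<lambda>x. s \<odot>\<^bsub>M\<^esub> x) ` carrier M \<subseteq> N)"

text \<open>
  HOL cannot quantify over carrier types inside a formula, so \<open>F\<close> and \<open>K\<close> below have elements
  of the fixed type \<open>nat \<Rightarrow> 'r\<close>.  This loses nothing: a finitely generated free module is
  isomorphic to some \<open>R\<^sup>n\<close>, which lives in \<open>nat \<Rightarrow> 'r\<close>, and \<open>K\<close> is isomorphic to its image in \<open>F\<close>.
\<close>

definition S_finitely_presented ::
  "('r, 'z) ring_scheme \<Rightarrow> 'r set \<Rightarrow> ('r, 'm, 'x) module_scheme \<Rightarrow> bool"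
  where "S_finitely_presented R S M \<longleftrightarrow> module R M \<and>
    (\<exists>(K :: ('r, nat \<Rightarrow> 'r) module) (F :: ('r, nat \<Rightarrow> 'r) module) i p.
       short_exact R K F M i p \<and> S_finite R S K \<and>
       finitely_generated R F \<and> free_module R F)"

definition S_coherent ::
  "('r, 'z) ring_scheme \<Rightarrow> 'r set \<Rightarrow> ('r, 'm, 'x) module_scheme \<Rightarrow> bool"
  where "S_coherent R S M \<longleftrightarrow> finitely_generated R M \<and>
    (\<forall>N. submodule R N M \<and> finitely_generated R (M\<lparr>carrier := N\<rparr>) \<longrightarrow>
         S_finitely_presented R S (M\<lparr>carrier := N\<rparr>))"

text \<open>
  External direct sum of a family, with families made canonical by being \<open>undefined\<close> outside \<open>I\<close>.
  The fields \<open>mult\<close> and \<open>one\<close> only exist because module records extend ring records; they carry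
  no meaning for modules.
\<close>

definition direct_sum_family ::
  "'i set \<Rightarrow> ('i \<Rightarrow> ('r, 'm, 'x) module_scheme) \<Rightarrow> ('r, 'i \<Rightarrow> 'm) module"
  where "direct_sum_family I M =
    \<lparr>carrier = {x \<in> (\<Pi>\<^sub>E i\<in>I. carrier (M i)). finite {i \<in> I. x i \<noteq> \<zero>\<^bsub>M i\<^esub>}},
     mult = (\<lambda>x y. \<lambda>i\<in>I. \<zero>\<^bsub>M i\<^esub>),
     one = (\<lambda>i\<in>I. \<zero>\<^bsub>M i\<^esub>),
     zero = (\<lambda>i\<in>I. \<zero>\<^bsub>M i\<^esub>),
     add = (\<lambda>x y. \<lambda>i\<in>I. x i \<oplus>\<^bsub>M i\<^esub> y i),
     smult = (\<lambda>r x. \<lambda>i\<in>I. r \<odot>\<^bsub>M i\<^esub> x i)\<rparr>"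

end

theory Submission
  imports Defs
begin

text \<open>
  Schanuel's lemma shows that a finitely generated module is \<open>S\<close>-finitely presented iff the relations
  of one, equivalently of every, finite generating family form an \<open>S\<close>-finite submodule of \<open>R\<^sup>n\<close>.
  Hence a finitely generated module is \<open>S\<close>-coherent iff each of its finite families has an \<open>S\<close>-finite
  module of relations. Injective maps preserve relations, which settles the third assertion; for the
  other two, the relations of a family are compared with those of a family in a neighbouring module of
  the sequence, at the cost of a further factor from \<open>S\<close>. Finite direct sums follow by induction.
\<close>

subsection \<open>Spans and homomorphisms\<close>

text \<open>\<open>S_coherent\<close> supplies, for each finitely generated submodule, some
  presentation with an unknown free module \<open>F\<close> and kernel \<open>K\<close>. Arguing
  with these directly would mean transporting presentations along \<open>f\<close> and
  \<open>g\<close> and comparing them each time. In terms of a family, a submodule and its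
  presentation become one linear map from \<open>R^n\<close> and its kernel, and the arguments
  become manipulations of coefficient vectors inside \<open>func_space\<close>; the comparison of
  presentations is made once, in \<open>S_finite_relations_change\<close>. Index sets are treated
  asymmetrically. Families whose relations are consumed (\<open>S_coherent_relations\<close>) may
  have an index set of any type, so that a basis or a set of relations can index itself. Families
  whose relations are produced (\<open>S_coherentI\<close>) are indexed by \<open>{..<n}\<close>,
  because \<open>S_finitely_presented\<close> fixes the element type
  \<open>nat \<Rightarrow> 'r\<close>. Changing the family costs no factor from \<open>S\<close>.
  Quotient and extension each end with a product \<open>t \<otimes> s\<close>, one factor from each
  of the two finiteness assumptions; this is where closure of \<open>S\<close> under multiplication
  enters.\<close>

context module
begin

lemma span_subset_spanI: "A \<subseteq> span B \<Longrightarrow> B \<subseteq> carrier M \<Longrightarrow> span A \<subseteq> span B"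
  by (simp add: span_is_subset span_is_submodule)

lemma finsum_in_submodule:
  assumes "submodule R N M" and "f \<in> I \<rightarrow> N"
  shows "finsum M f I \<in> N"
proof -
  interpret N: submodule R N M by fact
  show ?thesis
    using assms(2) N.subset
  proof (induction I rule: infinite_finite_induct)
    case (insert x F)
    then have "f \<in> F \<rightarrow> carrier M" "f x \<in> carrier M" by auto
    with insert show ?case by simp
  qed auto
qed

lemma finitely_generated_submodule_iff:
  assumes "submodule R N M"
  shows "finitely_generated R (M\<lparr>carrier := N\<rparr>) \<longleftrightarrow> (\<exists>A. finite A \<and> A \<subseteq> N \<and> span A = N)"
  using assms submodule_is_module span_li_not_depend(1)
  unfolding finitely_generated_def by auto

lemma S_finite_iff:
  "S_finite R S M \<longleftrightarrow>
    (\<exists>A s. finite A \<and> A \<subseteq> carrier M \<and> s \<in> S \<and> (\<forall>x\<in>carrier M. s \<odot>\<^bsub>M\<^esub> x \<in> span A))"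
  (is "_ \<longleftrightarrow> (\<exists>A s. ?P A s)")
proof
  assume "S_finite R S M"
  then obtain N s where N: "submodule R N M" "finitely_generated R (M\<lparr>carrier := N\<rparr>)"
    "s \<in> S" "(\<lambda>x. s \<odot>\<^bsub>M\<^esub> x) ` carrier M \<subseteq> N"
    unfolding S_finite_def by blast
  then obtain A where "finite A" "A \<subseteq> N" "span A = N"
    using finitely_generated_submodule_iff by blast
  then show "\<exists>A s. ?P A s"
    using N submodule.subset[OF N(1)] by blast
next
  assume "\<exists>A s. ?P A s"
  then obtain A s where A: "?P A s" by blast
  then have "submodule R (span A) M" by (simp add: span_is_submodule)
  moreover have "finitely_generated R (M\<lparr>carrier := span A\<rparr>)"
    using A calculation finitely_generated_submodule_iff in_own_span by blast
  ultimately show "S_finite R S M"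
    using A module_axioms unfolding S_finite_def by blast
qed

text \<open>Spans of subsets of \<open>N\<close> agree whether they are computed in \<open>N\<close>
  or in \<open>M\<close>, so S-finiteness of a relation module can be tested with spans taken in the
  ambient \<open>func_space\<close>.\<close>

lemma S_finite_submodule_iff:
  assumes "submodule R N M"
  shows "S_finite R S (M\<lparr>carrier := N\<rparr>) \<longleftrightarrow>
    (\<exists>A s. finite A \<and> A \<subseteq> N \<and> s \<in> S \<and> (\<forall>x\<in>N. s \<odot>\<^bsub>M\<^esub> x \<in> span A))"
proof -
  interpret N: module R "M\<lparr>carrier := N\<rparr>" using assms by (rule submodule_is_module)
  have "N.span A = span A" if "A \<subseteq> N" for A
    using that assms by (rule span_li_not_depend(1))
  then show ?thesis
    unfolding N.S_finite_iff by (simp cong: conj_cong)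
qed

end

lemma family_lift:
  assumes "y \<in> I \<rightarrow> g ` C"
  shows "\<exists>x. x \<in> I \<rightarrow> C \<and> (\<forall>i\<in>I. g (x i) = y i)"
  using assms by (intro exI[of _ "\<lambda>i. inv_into C g (y i)"]) (auto simp: Pi_iff inv_into_into f_inv_into_f)

context mod_hom
begin

lemma preimage_submodule:
  assumes "submodule R L N"
  shows "submodule R {x \<in> carrier M. f x \<in> L} M"
proof -
  interpret L: submodule R L N by fact
  show ?thesis by unfold_locales auto
qed

lemma image_submodule:
  assumes "submodule R K M"
  shows "submodule R (f ` K) N"
proof -
  interpret K: submodule R K M by fact
  have *: "\<And>x. x \<in> K \<Longrightarrow> x \<in> carrier M" using K.subset by auto
  show ?thesis
  proof
    show "f ` K \<subseteq> carrier N" using * by auto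
    show "v \<oplus>\<^bsub>N\<^esub> w \<in> f ` K" if "v \<in> f ` K" "w \<in> f ` K" for v w
      using that * K.m_closed by (force simp flip: f_add)
    show "\<zero>\<^bsub>N\<^esub> \<in> f ` K" using K.zero_closed f0_is_0 by (metis imageI)
    show "c \<odot>\<^bsub>N\<^esub> v \<in> f ` K" if "c \<in> carrier R" "v \<in> f ` K" for c v
      using that * K.smult_closed by (force simp flip: f_smult)
  qed
qed

lemma image_span:
  assumes "A \<subseteq> carrier M"
  shows "f ` M.span A = N.span (f ` A)"
proof
  have fA: "f ` A \<subseteq> carrier N" using assms by auto
  have "M.span A \<subseteq> {x \<in> carrier M. f x \<in> N.span (f ` A)}"
    using assms N.in_own_span[OF fA]
    by (intro M.span_is_subset preimage_submodule N.span_is_submodule fA) auto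
  then show "f ` M.span A \<subseteq> N.span (f ` A)" by auto
  show "N.span (f ` A) \<subseteq> f ` M.span A"
    by (intro N.span_is_subset image_submodule M.span_is_submodule assms image_mono M.in_own_span)
qed

lemma trivial_ker_inj:
  assumes "\<And>x. x \<in> carrier M \<Longrightarrow> f x = \<zero>\<^bsub>N\<^esub> \<Longrightarrow> x = \<zero>\<^bsub>M\<^esub>"
  shows "inj_on f (carrier M)"
proof (rule inj_onI)
  fix x y assume xy: "x \<in> carrier M" "y \<in> carrier M" "f x = f y"
  then have "f (x \<ominus>\<^bsub>M\<^esub> y) = \<zero>\<^bsub>N\<^esub>" by simp
  then have "x \<ominus>\<^bsub>M\<^esub> y = \<zero>\<^bsub>M\<^esub>" using xy by (intro assms M.M.minus_closed) auto
  then show "x = y" using xy by simp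
qed

text \<open>Unlike \<open>hom_sum\<close> of the library, this allows an index set outside the carrier.\<close>
lemma hom_finsum:
  assumes "g \<in> I \<rightarrow> carrier M"
  shows "f (\<Oplus>\<^bsub>M\<^esub>i\<in>I. g i) = (\<Oplus>\<^bsub>N\<^esub>i\<in>I. f (g i))"
  using assms
proof (induction I rule: infinite_finite_induct)
  case (insert x F)
  then have "g \<in> F \<rightarrow> carrier M" "g x \<in> carrier M" "(\<lambda>i. f (g i)) \<in> F \<rightarrow> carrier N" by auto
  with insert show ?case by simp
qed auto

end

subsection \<open>Relations of a family\<close>

text \<open>For fixed \<open>y\<close> this is the linear map from \<open>R^I\<close> that sends
  unit vectors to the members of \<open>y\<close>. Unlike \<open>lincomb\<close> it is indexed by a
  family, not by a set of vectors, so members that coincide, for instance after applying a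
  homomorphism, keep separate coefficients.\<close>

definition combination ::
  "('r, 'm, 'x) module_scheme \<Rightarrow> 'i set \<Rightarrow> ('i \<Rightarrow> 'm) \<Rightarrow> ('i \<Rightarrow> 'r) \<Rightarrow> 'm"
  where "combination M I y a = (\<Oplus>\<^bsub>M\<^esub>i\<in>I. a i \<odot>\<^bsub>M\<^esub> y i)"

text \<open>The first syzygy module of the family \<open>y\<close>. Extensional coefficient
  functions make it a subset of the carrier of \<open>func_space\<close>.\<close>

definition relations ::
  "('r, 'z) ring_scheme \<Rightarrow> ('r, 'm, 'x) module_scheme \<Rightarrow> 'i set \<Rightarrow> ('i \<Rightarrow> 'm) \<Rightarrow> ('i \<Rightarrow> 'r) set"
  where "relations R M I y = {a \<in> I \<rightarrow>\<^sub>E carrier R. combination M I y a = \<zero>\<^bsub>M\<^esub>}"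

abbreviation relation_module ::
  "('r, 'z) ring_scheme \<Rightarrow> ('r, 'm, 'x) module_scheme \<Rightarrow> 'i set \<Rightarrow> ('i \<Rightarrow> 'm) \<Rightarrow>
   ('r, 'i \<Rightarrow> 'r) module"
  where "relation_module R M I y \<equiv> (ring.func_space R I)\<lparr>carrier := relations R M I y\<rparr>"

definition unit_vector :: "('r, 'z) ring_scheme \<Rightarrow> 'i set \<Rightarrow> 'i \<Rightarrow> 'i \<Rightarrow> 'r"
  where "unit_vector R I i = (\<lambda>j\<in>I. if j = i then \<one>\<^bsub>R\<^esub> else \<zero>\<^bsub>R\<^esub>)"

context cring
begin

lemma carrier_func_space [simp]: "carrier (func_space I) = I \<rightarrow>\<^sub>E carrier R"
  and zero_func_space: "\<zero>\<^bsub>func_space I\<^esub> = (\<lambda>i\<in>I. \<zero>)"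
  and add_func_space: "a \<oplus>\<^bsub>func_space I\<^esub> b = (\<lambda>i\<in>I. a i \<oplus> b i)"
  and smult_func_space: "c \<odot>\<^bsub>func_space I\<^esub> a = (\<lambda>i\<in>I. c \<otimes> a i)"
  by (simp_all add: func_space_def)

lemma unit_vector_closed [simp]: "unit_vector R I i \<in> I \<rightarrow>\<^sub>E carrier R"
  by (simp add: unit_vector_def)

lemma finsum_func_space_apply:
  assumes "g \<in> A \<rightarrow> carrier (func_space I)" and "i \<in> I"
  shows "(\<Oplus>\<^bsub>func_space I\<^esub>v\<in>A. g v) i = (\<Oplus>v\<in>A. g v i)"
  using assms(1)
proof (induction A rule: infinite_finite_induct)
  case (insert x F)
  interpret F: module R "func_space I" by (rule func_space_is_module)
  have "g \<in> F \<rightarrow> carrier (func_space I)" "g x \<in> carrier (func_space I)"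
    "(\<lambda>v. g v i) \<in> F \<rightarrow> carrier R" "g x i \<in> carrier R"
    using insert.prems assms(2) by auto
  with insert assms(2) show ?case by (simp add: add_func_space)
\<comment> \<open>What remains are the infinite and the empty index set. Every sum is zero there, in
  the infinite case by the convention built into \<open>finprod_def\<close>.\<close>
qed (use assms(2) in \<open>simp_all add: zero_func_space finsum_def finprod_def\<close>)

lemma combination_unit_vector:
  assumes "finite I" and "a \<in> I \<rightarrow>\<^sub>E carrier R"
  shows "combination (func_space I) I (unit_vector R I) a = a"
proof -
  interpret F: module R "func_space I" by (rule func_space_is_module)
  let ?b = "combination (func_space I) I (unit_vector R I) a"
  have closed: "(\<lambda>j. a j \<odot>\<^bsub>func_space I\<^esub> unit_vector R I j) \<in> I \<rightarrow> carrier (func_space I)"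
    using assms(2) by (intro funcsetI F.smult_closed) auto
  then have "?b \<in> carrier (func_space I)"
    unfolding combination_def by (rule F.finsum_closed)
  moreover have "?b i = a i" if "i \<in> I" for i
  proof -
    have "?b i = (\<Oplus>j\<in>I. if i = j then a j else \<zero>)"
      unfolding combination_def finsum_func_space_apply[OF closed that]
      using assms(2) that by (intro finsum_cong') (auto simp: smult_func_space unit_vector_def PiE_mem[OF assms(2)])
    also have "\<dots> = a i"
      using assms that by (intro finsum_singleton) auto
    finally show ?thesis .
  qed
  ultimately show ?thesis
    using assms(2) by (intro PiE_ext[of _ I "\<lambda>_. carrier R"]) auto
qed

end

context module
begin

lemma combination_mod_hom:
  assumes "y \<in> I \<rightarrow> carrier M"
  shows "mod_hom R (func_space I) M (combination M I y)"
proof -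
  interpret F: module R "func_space I" by (rule func_space_is_module)
  have "combination M I y \<in> module_hom R (func_space I) M"
    unfolding module_hom_def
  proof (intro CollectI conjI allI impI funcsetI)
    fix a b assume "a \<in> carrier (func_space I) \<and> b \<in> carrier (func_space I)"
    then have ab: "a \<in> I \<rightarrow> carrier R" "b \<in> I \<rightarrow> carrier R" by auto
    have "combination M I y (a \<oplus>\<^bsub>func_space I\<^esub> b) = (\<Oplus>\<^bsub>M\<^esub>i\<in>I. a i \<odot>\<^bsub>M\<^esub> y i \<oplus>\<^bsub>M\<^esub> b i \<odot>\<^bsub>M\<^esub> y i)"
      unfolding combination_def using assms ab
      by (intro finsum_cong') (auto simp: add_func_space smult_l_distr Pi_iff)
    also have "\<dots> = combination M I y a \<oplus>\<^bsub>M\<^esub> combination M I y b"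
      unfolding combination_def using assms ab by (intro finsum_addf) auto
    finally show "combination M I y (a \<oplus>\<^bsub>func_space I\<^esub> b) = \<dots>" .
  next
    fix c a assume ca: "c \<in> carrier R \<and> a \<in> carrier (func_space I)"
    have "c \<odot>\<^bsub>M\<^esub> combination M I y a = (\<Oplus>\<^bsub>M\<^esub>i\<in>I. c \<odot>\<^bsub>M\<^esub> (a i \<odot>\<^bsub>M\<^esub> y i))"
      unfolding combination_def using assms ca by (intro finsum_smult) auto
    also have "\<dots> = combination M I y (c \<odot>\<^bsub>func_space I\<^esub> a)"
      unfolding combination_def using assms ca
      by (intro finsum_cong') (auto simp: smult_func_space smult_assoc1 Pi_iff PiE_iff)
    finally show "combination M I y (c \<odot>\<^bsub>func_space I\<^esub> a) = c \<odot>\<^bsub>M\<^esub> combination M I y a" ..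
  next
    fix a assume "a \<in> carrier (func_space I)"
    then show "combination M I y a \<in> carrier M"
      unfolding combination_def using assms by (intro finsum_closed) auto
  qed
  then show ?thesis
    by (simp add: mod_hom_def mod_hom_axioms_def F.module_axioms module_axioms)
qed

lemma relations_submodule:
  assumes "y \<in> I \<rightarrow> carrier M"
  shows "submodule R (relations R M I y) (func_space I)"
proof -
  interpret y: mod_hom R "func_space I" M "combination M I y"
    using assms by (rule combination_mod_hom)
  show ?thesis using y.ker_is_submodule by (simp add: y.ker_def relations_def)
qed

end

lemma (in cring) span_unit_vectors:
  assumes "finite I"
  shows "module.span R (func_space I) (unit_vector R I ` I) = carrier (func_space I)"
proof -
  interpret F: module R "func_space I" by (rule func_space_is_module)
  have sub: "unit_vector R I ` I \<subseteq> carrier (func_space I)"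
    by (simp add: image_subset_iff)
  have "a \<in> F.span (unit_vector R I ` I)" if "a \<in> carrier (func_space I)" for a
  proof -
    interpret E: submodule R "F.span (unit_vector R I ` I)" "func_space I"
      using sub by (rule F.span_is_submodule)
    have "combination (func_space I) I (unit_vector R I) a \<in> F.span (unit_vector R I ` I)"
      unfolding combination_def using that F.in_own_span[OF sub]
      by (intro F.finsum_in_submodule E.submodule_axioms funcsetI E.smult_closed) auto
    then show ?thesis
      using that assms by (simp add: combination_unit_vector)
  qed
  then show ?thesis using F.span_is_subset2[OF sub] by auto
qed

text \<open>Evaluating a vanishing linear combination at coordinate \<open>i\<close> isolates the
  coefficient of the \<open>i\<close>-th unit vector.\<close>

lemma (in cring) unit_vectors_lin_indpt:
  assumes "finite I"
  shows "\<not> module.lin_dep R (func_space I) (unit_vector R I ` I)"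
proof -
  interpret F: module R "func_space I" by (rule func_space_is_module)
  let ?E = "unit_vector R I ` I"
  have sub: "?E \<subseteq> carrier (func_space I)" by (simp add: image_subset_iff)
  have "\<forall>v\<in>?E. c v = \<zero>" if c: "c \<in> ?E \<rightarrow> carrier R" and 0: "F.lincomb c ?E = \<zero>\<^bsub>func_space I\<^esub>" for c
  proof
    fix v assume "v \<in> ?E"
    then obtain i where i: "i \<in> I" "v = unit_vector R I i" by auto
    have "\<zero> = F.lincomb c ?E i" using 0 i by (simp add: zero_func_space)
    also have "\<dots> = (\<Oplus>w\<in>?E. (c w \<odot>\<^bsub>func_space I\<^esub> w) i)"
      unfolding F.lincomb_def using c i sub
      by (intro finsum_func_space_apply funcsetI F.smult_closed) (auto simp del: carrier_func_space)
    also have "\<dots> = (\<Oplus>w\<in>?E. if v = w then c w else \<zero>)"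
    proof (intro finsum_cong')
      fix w assume w: "w \<in> ?E"
      \<comment> \<open>The case split compares vectors, not indices: \<open>lincomb\<close> sums
        over a set of vectors, and over the zero ring all unit vectors coincide. If \<open>w\<close>
        differs from \<open>v\<close>, then so do their indices, and entry \<open>i\<close> of
        \<open>w\<close> is zero.\<close>
      have "w i = (if v = w then \<one> else \<zero>)"
        using w i by (cases "v = w") (auto simp: unit_vector_def)
      then show "(c w \<odot>\<^bsub>func_space I\<^esub> w) i = (if v = w then c w else \<zero>)"
        using c i w by (auto simp: smult_func_space Pi_iff)
    qed (use c in auto)
    also have "\<dots> = c v"
      using assms c \<open>v \<in> ?E\<close> by (intro finsum_singleton) auto
    finally show "c v = \<zero>" ..
  qed
  then show ?thesis
    using assms sub by (intro F.finite_lin_indpt2) (auto simp del: carrier_func_space)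
qed

lemma mod_hom_diff:
  assumes "mod_hom R M N f" and "mod_hom R M N g"
  shows "mod_hom R M N (\<lambda>x. f x \<ominus>\<^bsub>N\<^esub> g x)"
proof -
  interpret f: mod_hom R M N f by fact
  interpret g: mod_hom R M N g by fact
  have "(\<lambda>x. f x \<ominus>\<^bsub>N\<^esub> g x) \<in> module_hom R M N"
    unfolding module_hom_def
    by (auto simp: a_minus_def f.N.M.minus_add f.N.M.a_ac f.N.smult_r_distr f.N.smult_r_minus)
  then show ?thesis
    by (simp add: mod_hom_def mod_hom_axioms_def f.M.module_axioms f.N.module_axioms)
qed

lemma mod_hom_compose:
  assumes "mod_hom R L M f" and "mod_hom R M N g"
  shows "mod_hom R L N (\<lambda>x. g (f x))"
proof -
  interpret f: mod_hom R L M f by fact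
  interpret g: mod_hom R M N g by fact
  have "(\<lambda>x. g (f x)) \<in> module_hom R L N"
    unfolding module_hom_def by auto
  then show ?thesis
    by (simp add: mod_hom_def mod_hom_axioms_def f.M.module_axioms g.N.module_axioms)
qed

lemma (in module) mod_hom_inclusion:
  assumes "submodule R N M"
  shows "mod_hom R (M\<lparr>carrier := N\<rparr>) M (\<lambda>x. x)"
  using submodule.subset[OF assms] submodule_is_module[OF assms] module_axioms
  by (auto simp: mod_hom_def mod_hom_axioms_def module_hom_def)

lemma (in mod_hom) hom_combination:
  assumes "y \<in> I \<rightarrow> carrier M" and "a \<in> I \<rightarrow> carrier R"
  shows "f (combination M I y a) = combination N I (\<lambda>i. f (y i)) a"
proof -
  have "f (combination M I y a) = (\<Oplus>\<^bsub>N\<^esub>i\<in>I. f (a i \<odot>\<^bsub>M\<^esub> y i))"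
    unfolding combination_def using assms by (intro hom_finsum) auto
  also have "\<dots> = combination N I (\<lambda>i. f (y i)) a"
    unfolding combination_def using assms by (intro N.M.finsum_cong') (auto simp: Pi_iff)
  finally show ?thesis .
qed

lemma (in mod_hom) relations_inj:
  assumes "inj_on f (carrier M)" and "y \<in> I \<rightarrow> carrier M"
  shows "relations R N I (\<lambda>i. f (y i)) = relations R M I y"
proof -
  interpret y: mod_hom R "func_space I" M "combination M I y"
    using assms(2) by (rule M.combination_mod_hom)
  have "combination N I (\<lambda>i. f (y i)) a = \<zero>\<^bsub>N\<^esub> \<longleftrightarrow> combination M I y a = \<zero>\<^bsub>M\<^esub>"
    if "a \<in> I \<rightarrow>\<^sub>E carrier R" for a
  proof -
    have "a \<in> I \<rightarrow> carrier R" "combination M I y a \<in> carrier M"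
      using that y.f_im by auto
    then show ?thesis
      using inj_on_eq_iff[OF assms(1), of "combination M I y a" "\<zero>\<^bsub>M\<^esub>"]
      by (simp flip: hom_combination[OF assms(2)])
  qed
  then show ?thesis unfolding relations_def by auto
qed

context module
begin

lemma combination_cong:
  assumes "\<And>i. i \<in> I \<Longrightarrow> x i = y i" and "y \<in> I \<rightarrow> carrier M" and "a \<in> I \<rightarrow> carrier R"
  shows "combination M I x a = combination M I y a"
  unfolding combination_def using assms by (intro finsum_cong') (auto simp: Pi_iff)

lemma combination_unit_vector_eq:
  assumes "finite I" and "y \<in> I \<rightarrow> carrier M" and "i \<in> I"
  shows "combination M I y (unit_vector R I i) = y i"
proof -
  have "combination M I y (unit_vector R I i) = (\<Oplus>\<^bsub>M\<^esub>j\<in>I. if i = j then y j else \<zero>\<^bsub>M\<^esub>)"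
    unfolding combination_def using assms
    by (intro finsum_cong') (auto simp: unit_vector_def Pi_iff)
  also have "\<dots> = y i"
    using assms by (intro finsum_singleton) auto
  finally show ?thesis .
qed

lemma combination_image:
  assumes "finite I" and "y \<in> I \<rightarrow> carrier M"
  shows "combination M I y ` (I \<rightarrow>\<^sub>E carrier R) = span (y ` I)"
proof -
  interpret y: mod_hom R "func_space I" M "combination M I y"
    using assms(2) by (rule combination_mod_hom)
  have "combination M I y ` unit_vector R I ` I = y ` I"
    using assms by (simp add: image_image combination_unit_vector_eq)
  then show ?thesis
    using y.image_span[of "unit_vector R I ` I"] span_unit_vectors[OF assms(1)]
    by (simp add: image_subset_iff)
qed

lemma coefficients_exist:
  assumes "finite J" and "y \<in> J \<rightarrow> carrier M" and "x ` I \<subseteq> span (y ` J)"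
  shows "\<exists>w. w \<in> I \<rightarrow> carrier (func_space J) \<and> (\<forall>i\<in>I. combination M J y (w i) = x i)"
  using assms combination_image[OF assms(1,2)] by (intro family_lift) auto

end

subsection \<open>Presentations and coherence via relations\<close>

context module
begin

text \<open>A version of Schanuel's lemma: writing each of the two families in terms of the other gives
  \<open>h : R\<^sup>I \<rightarrow> R\<^sup>J\<close> and \<open>k : R\<^sup>J \<rightarrow> R\<^sup>I\<close> over \<open>M\<close>, and the relations of \<open>y\<close> are generated by
  the \<open>v - h (k v)\<close> and the images under \<open>h\<close> of the relations of \<open>x\<close>.\<close>
lemma S_finite_relations_change:
  assumes S: "S \<subseteq> carrier R" and fin: "finite I" "finite J"
    and x: "x \<in> I \<rightarrow> carrier M" and y: "y \<in> J \<rightarrow> carrier M"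
    and xy: "x ` I \<subseteq> span (y ` J)" and yx: "y ` J \<subseteq> span (x ` I)"
    and Sfin: "S_finite R S (relation_module R M I x)"
  shows "S_finite R S (relation_module R M J y)"
proof -
  interpret FI: module R "func_space I" by (rule func_space_is_module)
  interpret FJ: module R "func_space J" by (rule func_space_is_module)
  interpret X: mod_hom R "func_space I" M "combination M I x"
    using x by (rule combination_mod_hom)
  interpret Y: mod_hom R "func_space J" M "combination M J y"
    using y by (rule combination_mod_hom)
  from coefficients_exist[OF fin(2) y xy] obtain w
    where w: "w \<in> I \<rightarrow> carrier (func_space J) \<and> (\<forall>i\<in>I. combination M J y (w i) = x i)" ..
  from coefficients_exist[OF fin(1) x yx] obtain u
    where u: "u \<in> J \<rightarrow> carrier (func_space I) \<and> (\<forall>j\<in>J. combination M I x (u j) = y j)" ..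
  define h where "h = combination (func_space J) I w"
  define k where "k = combination (func_space I) J u"
  define d where "d v = v \<ominus>\<^bsub>func_space J\<^esub> h (k v)" for v
  interpret h: mod_hom R "func_space I" "func_space J" h
    unfolding h_def using w by (intro FJ.combination_mod_hom) simp
  interpret k: mod_hom R "func_space J" "func_space I" k
    unfolding k_def using u by (intro FI.combination_mod_hom) simp
  have "mod_hom R (func_space J) (func_space J) (\<lambda>v. v)"
    by (simp add: mod_hom_def mod_hom_axioms_def module_hom_def FJ.module_axioms)
  then interpret d: mod_hom R "func_space J" "func_space J" d
    unfolding d_def
    by (rule mod_hom_diff) (rule mod_hom_compose[OF k.mod_hom_axioms h.mod_hom_axioms])
  have Yh: "combination M J y (h a) = combination M I x a" if "a \<in> carrier (func_space I)" for a
  proof -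
    have a: "a \<in> I \<rightarrow> carrier R" using that by auto
    have "combination M J y (h a) = combination M I (\<lambda>i. combination M J y (w i)) a"
      unfolding h_def using w a by (intro Y.hom_combination) auto
    also have "\<dots> = combination M I x a"
      using w x a by (intro combination_cong) auto
    finally show ?thesis .
  qed
  have Xk: "combination M I x (k a) = combination M J y a" if "a \<in> carrier (func_space J)" for a
  proof -
    have a: "a \<in> J \<rightarrow> carrier R" using that by auto
    have "combination M I x (k a) = combination M J (\<lambda>j. combination M I x (u j)) a"
      unfolding k_def using u a by (intro X.hom_combination) auto
    also have "\<dots> = combination M J y a"
      using u y a by (intro combination_cong) auto
    finally show ?thesis .
  qed
  obtain A s where A: "finite A" "A \<subseteq> relations R M I x" "s \<in> S"
    "\<And>v. v \<in> relations R M I x \<Longrightarrow> s \<odot>\<^bsub>func_space I\<^esub> v \<in> FI.span A"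
    using Sfin unfolding FI.S_finite_submodule_iff[OF relations_submodule[OF x]] by blast
  have AF: "A \<subseteq> carrier (func_space I)" using A(2) by (auto simp: relations_def)
  have s: "s \<in> carrier R" using A(3) S by auto
  let ?E = "unit_vector R J ` J"
  have E: "?E \<subseteq> carrier (func_space J)" by (simp add: image_subset_iff)
  let ?B = "d ` ?E \<union> h ` A"
  have d_rel: "d v \<in> relations R M J y" if v: "v \<in> carrier (func_space J)" for v
  proof -
    have kv: "k v \<in> carrier (func_space I)" using v by (rule k.f_im)
    then have "combination M J y (d v) = \<zero>\<^bsub>M\<^esub>"
      unfolding d_def using v Yh[OF kv] Xk[OF v] h.f_im[OF kv] Y.f_im[OF v]
      by (simp del: carrier_func_space)
    then show ?thesis using d.f_im[OF v] by (simp add: relations_def)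
  qed
  have h_rel: "h a \<in> relations R M J y" if "a \<in> relations R M I x" for a
    using that h.f_im[of a] Yh[of a] by (simp add: relations_def)
  have "?B \<subseteq> relations R M J y"
    using d_rel h_rel A(2) E by blast
  moreover have "s \<odot>\<^bsub>func_space J\<^esub> v \<in> FJ.span ?B" if v: "v \<in> relations R M J y" for v
  proof -
    have vF: "v \<in> carrier (func_space J)" using v by (simp add: relations_def)
    have BF: "?B \<subseteq> carrier (func_space J)"
      using \<open>?B \<subseteq> relations R M J y\<close> by (auto simp: relations_def)
    interpret B: submodule R "FJ.span ?B" "func_space J"
      using BF by (rule FJ.span_is_submodule)
    let ?sv = "s \<odot>\<^bsub>func_space J\<^esub> v"
    have sv: "?sv \<in> carrier (func_space J)" using s vF by (rule FJ.smult_closed)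
    have "d ?sv \<in> d ` FJ.span ?E"
      using sv span_unit_vectors[OF fin(2)] by blast
    then have 1: "d ?sv \<in> FJ.span ?B"
      unfolding d.image_span[OF E] using FJ.span_is_monotone[of "d ` ?E" ?B] by blast
    have "k v \<in> relations R M I x"
      using v k.f_im[OF vF] Xk[OF vF] by (simp add: relations_def)
    then have "h (s \<odot>\<^bsub>func_space I\<^esub> k v) \<in> h ` FI.span A" using A(4) by blast
    then have 2: "h (k ?sv) \<in> FJ.span ?B"
      unfolding h.image_span[OF AF] using s vF FJ.span_is_monotone[of "h ` A" ?B]
      by (auto simp del: carrier_func_space)
    \<comment> \<open>Only the second summand needs the factor: \<open>d\<close> maps every vector
      into the span of the images of the unit vectors, whereas \<open>k v\<close> is a relation of
      \<open>x\<close> and has to be multiplied by \<open>s\<close> to reach the span of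
      \<open>A\<close>. Hence the same \<open>s\<close> serves for both families.\<close>
    have "?sv = d ?sv \<oplus>\<^bsub>func_space J\<^esub> h (k ?sv)"
      unfolding d_def using sv h.f_im[OF k.f_im[OF sv]]
      by (simp add: FJ.M.minus_eq FJ.M.a_assoc FJ.M.l_neg del: carrier_func_space)
    then show ?thesis using B.m_closed[OF 1 2] by simp
  qed
  ultimately show ?thesis
    unfolding FJ.S_finite_submodule_iff[OF relations_submodule[OF y]]
    using A(1,3) fin(2) by (intro exI[of _ ?B] exI[of _ s]) auto
qed

text \<open>The presentation is the standard one: \<open>F\<close> is \<open>R^n\<close>, mapped
  onto \<open>M\<close> by \<open>combination\<close>, and \<open>K\<close> is the relation module
  with its inclusion. Indexing by \<open>{..<n}\<close> gives both the required element
  type.\<close>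

lemma S_finitely_presentedI:
  fixes n :: nat
  assumes "y \<in> {..<n} \<rightarrow> carrier M" and "span (y ` {..<n}) = carrier M"
    and "S_finite R S (relation_module R M {..<n} y)"
  shows "S_finitely_presented R S M"
proof -
  let ?I = "{..<n}"
  interpret F: module R "func_space ?I" by (rule func_space_is_module)
  interpret Y: mod_hom R "func_space ?I" M "combination M ?I y"
    using assms(1) by (rule combination_mod_hom)
  have sub: "submodule R (relations R M ?I y) (func_space ?I)"
    using assms(1) by (rule relations_submodule)
  interpret i: mod_hom R "relation_module R M ?I y" "func_space ?I" "\<lambda>v. v"
    using sub by (rule F.mod_hom_inclusion)
  have E: "unit_vector R ?I ` ?I \<subseteq> carrier (func_space ?I)"
    by (simp add: image_subset_iff)
  have "short_exact R (relation_module R M ?I y) (func_space ?I) M (\<lambda>v. v) (combination M ?I y)"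
    unfolding short_exact_def i.ker_def i.im_def Y.ker_def Y.im_def
    using i.mod_hom_axioms Y.mod_hom_axioms combination_image[OF _ assms(1)] assms(2)
      submodule.zero_closed[OF sub]
    by (auto simp: relations_def)
  moreover have "finitely_generated R (func_space ?I)"
    unfolding finitely_generated_def using F.module_axioms E span_unit_vectors[of ?I] by blast
  moreover have "free_module R (func_space ?I)"
    unfolding free_module_def
    using F.module_axioms E span_unit_vectors[of ?I] unit_vectors_lin_indpt[of ?I] by blast
  ultimately show ?thesis
    unfolding S_finitely_presented_def using module_axioms assms(3) by blast
qed

text \<open>The basis from \<open>free_module\<close> may be infinite a priori, and the finite
  generating set is unrelated to it. Each generator involves finitely many basis elements; those
  occurring for some generator already span, and they remain linearly independent.\<close>

lemma finite_basis_exists: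
  assumes "finitely_generated R M" and "free_module R M"
  obtains B where "finite B" "B \<subseteq> carrier M" "\<not> lin_dep B" "span B = carrier M"
proof -
  obtain A where A: "finite A" "A \<subseteq> carrier M" "span A = carrier M"
    using assms(1) unfolding finitely_generated_def by blast
  obtain B where B: "B \<subseteq> carrier M" "\<not> lin_dep B" "span B = carrier M"
    using assms(2) unfolding free_module_def by blast
  have "\<forall>a\<in>A. \<exists>C. finite C \<and> C \<subseteq> B \<and> a \<in> span C"
  proof
    fix a assume "a \<in> A"
    then have "a \<in> span B" using A(2) B(3) by auto
    then obtain c C where "a = lincomb c C" "finite C" "C \<subseteq> B" "c \<in> C \<rightarrow> carrier R"
      unfolding span_def by auto
    then show "\<exists>C. finite C \<and> C \<subseteq> B \<and> a \<in> span C"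
      by (intro exI[of _ C]) (auto simp: span_def)
  qed
  from bchoice[OF this] obtain C
    where C: "\<forall>a\<in>A. finite (C a) \<and> C a \<subseteq> B \<and> a \<in> span (C a)" ..
  let ?C = "\<Union>a\<in>A. C a"
  have sub: "?C \<subseteq> B" using C by blast
  have "A \<subseteq> span ?C"
  proof
    fix a assume a: "a \<in> A"
    then have "span (C a) \<subseteq> span ?C" by (intro span_is_monotone) auto
    with a C show "a \<in> span ?C" by auto
  qed
  then have "span ?C = carrier M"
    using A(3) sub B(1) span_is_subset2[of ?C] span_subset_spanI[of A ?C] by blast
  then show thesis
    using that[of ?C] A(1) C sub B subset_li_is_li[OF B(2) sub] by blast
qed

lemma lin_indpt_combination_inj:
  assumes "finite B" and "B \<subseteq> carrier M" and "\<not> lin_dep B"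
  shows "inj_on (combination M B (\<lambda>v. v)) (B \<rightarrow>\<^sub>E carrier R)"
proof -
  interpret c: mod_hom R "func_space B" M "combination M B (\<lambda>v. v)"
    using assms(2) by (intro combination_mod_hom) auto
  have "a = \<zero>\<^bsub>func_space B\<^esub>"
    if a: "a \<in> carrier (func_space B)" and 0: "combination M B (\<lambda>v. v) a = \<zero>\<^bsub>M\<^esub>" for a
  proof -
    have "lincomb a B = \<zero>\<^bsub>M\<^esub>"
      using 0 by (simp add: combination_def lincomb_def)
    then have "a v = \<zero>" if "v \<in> B" for v
      using assms(1,3) a that lin_dep_crit[of B B a v] by auto
    then show ?thesis
      using a by (intro PiE_ext[of _ B "\<lambda>_. carrier R"]) (auto simp: zero_func_space)
  qed
  from c.trivial_ker_inj[OF this] show ?thesis by simp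
qed

text \<open>A finite basis \<open>B\<close> identifies \<open>F\<close> with \<open>R^B\<close>.
  Under this identification \<open>K\<close> becomes the relation module of the family
  \<open>p\<close> on \<open>B\<close>, which generates \<open>M\<close>; Schanuel then passes from
  this family to \<open>y\<close>.\<close>

lemma S_finitely_presented_relations:
  assumes S: "S \<subseteq> carrier R" and fp: "S_finitely_presented R S M"
    and J: "finite J" and y: "y \<in> J \<rightarrow> carrier M" and span_y: "span (y ` J) = carrier M"
  shows "S_finite R S (relation_module R M J y)"
proof -
  obtain K F :: "('a, nat \<Rightarrow> 'a) module" and i p
    where ex: "short_exact R K F M i p" and K: "S_finite R S K"
      and F: "finitely_generated R F" "free_module R F"
    using fp unfolding S_finitely_presented_def by blast
  interpret i: mod_hom R K F i using ex by (simp add: short_exact_def)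
  interpret p: mod_hom R F M p using ex by (simp add: short_exact_def)
  have exact: "i ` carrier K = {v \<in> carrier F. p v = \<zero>\<^bsub>M\<^esub>}" "p ` carrier F = carrier M"
    using ex by (auto simp: short_exact_def i.im_def p.im_def p.ker_def)
  obtain B where B: "finite B" "B \<subseteq> carrier F" "\<not> i.N.lin_dep B" "i.N.span B = carrier F"
    using i.N.finite_basis_exists[OF F] by blast
  interpret FB: module R "func_space B" by (rule func_space_is_module)
  have idB: "(\<lambda>v. v) \<in> B \<rightarrow> carrier F" and pB: "p \<in> B \<rightarrow> carrier M" using B(2) by auto
  let ?c = "combination F B (\<lambda>v. v)"
  interpret c: mod_hom R "func_space B" F ?c
    using idB by (rule i.N.combination_mod_hom)
  have c_inj: "inj_on ?c (carrier (func_space B))"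
    using i.N.lin_indpt_combination_inj[OF B(1-3)] by simp
  have c_surj: "?c ` carrier (func_space B) = carrier F"
    using i.N.combination_image[OF B(1) idB] B(4) by simp
  have pc: "combination M B p a = p (?c a)" if "a \<in> carrier (func_space B)" for a
    using p.hom_combination[OF idB, of a] PiE_mem[of a B "\<lambda>_. carrier R"] that by (simp add: Pi_iff)
  obtain A s where A: "finite A" "A \<subseteq> carrier K" "s \<in> S"
    "\<And>v. v \<in> carrier K \<Longrightarrow> s \<odot>\<^bsub>K\<^esub> v \<in> i.M.span A"
    using K unfolding i.M.S_finite_iff by blast
  have s: "s \<in> carrier R" using A(3) S by auto
  have "i ` A \<subseteq> ?c ` carrier (func_space B)"
    unfolding c_surj using A(2) by auto
  \<comment> \<open>\<open>C\<close> consists of the coordinate vectors, with respect to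
    \<open>B\<close>, of the images in \<open>F\<close> of the generators of
    \<open>K\<close>.\<close>
  from finite_subset_image[OF finite_imageI[OF A(1)] this] obtain C
    where "C \<subseteq> carrier (func_space B) \<and> finite C \<and> i ` A = ?c ` C" ..
  then have C: "C \<subseteq> carrier (func_space B)" "finite C" "i ` A = ?c ` C"
    by auto
  have "C \<subseteq> relations R M B p"
  proof
    fix a assume "a \<in> C"
    then have "?c a \<in> i ` carrier K" using C(3) A(2) by blast
    then show "a \<in> relations R M B p"
      using exact(1) pc[of a] C(1) \<open>a \<in> C\<close> by (auto simp: relations_def)
  qed
  moreover have "s \<odot>\<^bsub>func_space B\<^esub> v \<in> FB.span C" if v: "v \<in> relations R M B p" for v
  proof -
    have vF: "v \<in> carrier (func_space B)" using v by (simp add: relations_def)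
    have "?c v \<in> i ` carrier K"
      using v pc[OF vF] c.f_im[OF vF] exact(1) by (simp add: relations_def)
    then obtain x where x: "x \<in> carrier K" "?c v = i x" by blast
    \<comment> \<open>Since \<open>?c\<close> is injective, membership in the span of
      \<open>C\<close> may be tested in \<open>F\<close>, where the multiple by \<open>s\<close> is
      visible as coming from \<open>K\<close>.\<close>
    have "?c (s \<odot>\<^bsub>func_space B\<^esub> v) = i (s \<odot>\<^bsub>K\<^esub> x)"
      using s vF x by (simp del: carrier_func_space)
    also have "\<dots> \<in> i ` i.M.span A" using A(4) x(1) by blast
    also have "\<dots> = ?c ` FB.span C"
      using i.image_span[OF A(2)] c.image_span[OF C(1)] C(3) by simp
    finally show ?thesis
      using inj_on_image_mem_iff[OF c_inj FB.smult_closed[OF s vF] FB.span_is_subset2[OF C(1)]]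
      by simp
  qed
  ultimately have "S_finite R S (relation_module R M B p)"
    unfolding FB.S_finite_submodule_iff[OF relations_submodule[OF pB]]
    using C(2) A(3) by (intro exI[of _ C] exI[of _ s]) simp
  moreover have "span (p ` B) = carrier M"
    using p.image_span[OF B(2)] B(4) exact(2) by simp
  ultimately show ?thesis
    using S_finite_relations_change[OF S B(1) J pB y] span_y pB y by auto
qed

lemma relations_in_submodule:
  assumes "submodule R N M" and "y \<in> I \<rightarrow> N"
  shows "relations R (M\<lparr>carrier := N\<rparr>) I y = relations R M I y"
proof -
  interpret i: mod_hom R "M\<lparr>carrier := N\<rparr>" M "\<lambda>x. x"
    using assms(1) by (rule mod_hom_inclusion)
  show ?thesis using i.relations_inj[of y I] assms(2) by simp
qed

text \<open>The definition is applied to the submodule generated by the family, and relations do not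
  change when computed in that submodule instead of \<open>M\<close>.\<close>

lemma S_coherent_relations:
  assumes S: "S \<subseteq> carrier R" and coh: "S_coherent R S M"
    and J: "finite J" and y: "y \<in> J \<rightarrow> carrier M"
  shows "S_finite R S (relation_module R M J y)"
proof -
  let ?N = "span (y ` J)"
  have yM: "y ` J \<subseteq> carrier M" using y by auto
  have N: "submodule R ?N M" using yM by (rule span_is_submodule)
  have yN: "y \<in> J \<rightarrow> ?N" using in_own_span[OF yM] by auto
  interpret N: module R "M\<lparr>carrier := ?N\<rparr>" using N by (rule submodule_is_module)
  have "finitely_generated R (M\<lparr>carrier := ?N\<rparr>)"
    unfolding finitely_generated_submodule_iff[OF N]
    using in_own_span[OF yM] J by (intro exI[of _ "y ` J"]) simp
  then have "S_finitely_presented R S (M\<lparr>carrier := ?N\<rparr>)"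
    using coh N unfolding S_coherent_def by simp
  then have "S_finite R S (relation_module R (M\<lparr>carrier := ?N\<rparr>) J y)"
    using yN J span_li_not_depend(1)[OF in_own_span[OF yM] N]
    by (intro N.S_finitely_presented_relations S) auto
  then show ?thesis
    using relations_in_submodule[OF N yN] by simp
qed

text \<open>Converse to \<open>S_coherent_relations\<close>: a finite generating set of a submodule
  can be enumerated by some \<open>{..<n}\<close>, and the relations of this enumeration give the
  presentation.\<close>

lemma S_coherentI:
  assumes "finitely_generated R M"
    and rel: "\<And>(n::nat) y. y \<in> {..<n} \<rightarrow> carrier M \<Longrightarrow> S_finite R S (relation_module R M {..<n} y)"
  shows "S_coherent R S M"
  unfolding S_coherent_def
proof (intro conjI allI impI assms(1))
  fix N assume "submodule R N M \<and> finitely_generated R (M\<lparr>carrier := N\<rparr>)"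
  then have N: "submodule R N M" and fg: "finitely_generated R (M\<lparr>carrier := N\<rparr>)" by auto
  interpret N: module R "M\<lparr>carrier := N\<rparr>" using N by (rule submodule_is_module)
  obtain A where A: "finite A" "A \<subseteq> N" "span A = N"
    using fg finitely_generated_submodule_iff[OF N] by blast
  obtain n :: nat and y where y: "A = y ` {..<n}"
    using finite_imp_nat_seg_image_inj_on[OF A(1)] by (auto simp: lessThan_def)
  have yN: "y \<in> {..<n} \<rightarrow> N" using A(2) y by auto
  then have "S_finite R S (relation_module R M {..<n} y)"
    using submodule.subset[OF N] by (intro rel) auto
  then show "S_finitely_presented R S (M\<lparr>carrier := N\<rparr>)"
    using yN A y span_li_not_depend(1)[OF A(2) N] relations_in_submodule[OF N yN]
    by (intro N.S_finitely_presentedI[of y n]) auto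
qed

end

subsection \<open>Coherence in short exact sequences\<close>

lemma short_exact_iff:
  "short_exact R P N M f g \<longleftrightarrow> mod_hom R P N f \<and> mod_hom R N M g \<and> inj_on f (carrier P) \<and>
    f ` carrier P = {x \<in> carrier N. g x = \<zero>\<^bsub>M\<^esub>} \<and> g ` carrier N = carrier M"
proof (cases "mod_hom R P N f \<and> mod_hom R N M g")
  case True
  then interpret f: mod_hom R P N f by simp
  from True interpret g: mod_hom R N M g by simp
  have "{x \<in> carrier P. f x = \<zero>\<^bsub>N\<^esub>} = {\<zero>\<^bsub>P\<^esub>} \<longleftrightarrow> inj_on f (carrier P)"
  proof
    assume "{x \<in> carrier P. f x = \<zero>\<^bsub>N\<^esub>} = {\<zero>\<^bsub>P\<^esub>}"
    then show "inj_on f (carrier P)" by (intro f.trivial_ker_inj) auto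
  next
    assume "inj_on f (carrier P)"
    then have "x = \<zero>\<^bsub>P\<^esub>" if "x \<in> carrier P" "f x = \<zero>\<^bsub>N\<^esub>" for x
      using that inj_onD[of f "carrier P" x "\<zero>\<^bsub>P\<^esub>"] by simp
    then show "{x \<in> carrier P. f x = \<zero>\<^bsub>N\<^esub>} = {\<zero>\<^bsub>P\<^esub>}" by auto
  qed
  with True show ?thesis
    by (simp add: short_exact_def f.ker_def f.im_def g.ker_def g.im_def)
qed (auto simp: short_exact_def)

text \<open>This coordinate projection forgets the coefficients of adjoined generators when
  relations of an enlarged family are compared with those of the original one.\<close>

lemma (in cring) restrict_mod_hom:
  assumes "I \<subseteq> K"
  shows "mod_hom R (func_space K) (func_space I) (\<lambda>a. restrict a I)"
proof -
  have "(\<lambda>a. restrict a I) \<in> module_hom R (func_space K) (func_space I)"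
    using assms unfolding module_hom_def
    by (auto simp: add_func_space smult_func_space restrict_def fun_eq_iff)
  then show ?thesis
    by (simp add: mod_hom_def mod_hom_axioms_def func_space_is_module)
qed

context module
begin

lemma combination_closed:
  assumes "y \<in> I \<rightarrow> carrier M" and "a \<in> I \<rightarrow> carrier R"
  shows "combination M I y a \<in> carrier M"
  unfolding combination_def using assms by (intro finsum_closed) auto

lemma combination_Un_disjoint:
  assumes "finite I" "finite J" "I \<inter> J = {}"
    and "y \<in> I \<union> J \<rightarrow> carrier M" and "a \<in> I \<union> J \<rightarrow> carrier R"
  shows "combination M (I \<union> J) y a = combination M I y a \<oplus>\<^bsub>M\<^esub> combination M J y a"
  unfolding combination_def using assms by (intro finsum_Un_disjoint) auto

lemma combination_coeff_cong:
  assumes "\<And>i. i \<in> I \<Longrightarrow> a i = b i" and "y \<in> I \<rightarrow> carrier M" and "b \<in> I \<rightarrow> carrier R"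
  shows "combination M I y a = combination M I y b"
  unfolding combination_def using assms by (intro finsum_cong') (auto simp: Pi_iff)

end

text \<open>Adjoin to lifts of the generators of a submodule of \<open>M\<close> the generators of a finitely generated
  submodule of \<open>P\<close> absorbing \<open>s P\<close>: every relation in \<open>M\<close>, multiplied by \<open>s\<close>, extends to a
  relation of the enlarged family in \<open>N\<close>.\<close>
lemma S_coherent_quotient:
  assumes S: "submonoid S R" and ex: "short_exact R P N M f g"
    and P: "S_finite R S P" and N: "S_coherent R S N"
  shows "S_coherent R S M"
proof -
  interpret S: submonoid S R by (rule S)
  interpret R: cring R using ex by (simp add: short_exact_iff mod_hom_def module_def)
  interpret f: mod_hom R P N f using ex by (simp add: short_exact_iff)
  interpret g: mod_hom R N M g using ex by (simp add: short_exact_iff)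
  have exact: "f ` carrier P = {x \<in> carrier N. g x = \<zero>\<^bsub>M\<^esub>}" and surj: "g ` carrier N = carrier M"
    using ex by (simp_all add: short_exact_iff)
  obtain A s where A: "finite A" "A \<subseteq> carrier P" "s \<in> S"
    "\<And>x. x \<in> carrier P \<Longrightarrow> s \<odot>\<^bsub>P\<^esub> x \<in> f.M.span A"
    using P unfolding f.M.S_finite_iff by blast
  have s: "s \<in> carrier R" using A(3) S.subset by auto
  have fA: "f ` A \<subseteq> carrier N" using A(2) by auto
  show ?thesis
  proof (rule g.N.S_coherentI)
    obtain G where G: "finite G" "G \<subseteq> carrier N" "f.N.span G = carrier N"
      using N unfolding S_coherent_def finitely_generated_def by blast
    then have "g.N.span (g ` G) = carrier M" using g.image_span[OF G(2)] surj by simp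
    moreover have "g ` G \<subseteq> carrier M" using G(2) by auto
    ultimately show "finitely_generated R M"
      unfolding finitely_generated_def using G(1) g.N.module_axioms
      by (intro conjI exI[of _ "g ` G"]) auto
  next
    fix n :: nat and y assume y: "y \<in> {..<n} \<rightarrow> carrier M"
    let ?I = "{..<n}"
    have "y \<in> ?I \<rightarrow> g ` carrier N" unfolding surj by (rule y)
    from family_lift[OF this] obtain x
      where "x \<in> ?I \<rightarrow> carrier N \<and> (\<forall>i\<in>?I. g (x i) = y i)" ..
    then have x: "x \<in> ?I \<rightarrow> carrier N" "\<And>i. i \<in> ?I \<Longrightarrow> g (x i) = y i"
      by simp_all
    obtain k :: nat and z where z: "f ` A = z ` {..<k}"
      using finite_imp_nat_seg_image_inj_on[of "f ` A"] A(1) by (auto simp: lessThan_def)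
    let ?J = "{n..<n + k}"
    let ?K = "?I \<union> ?J"
    define Y where "Y i = (if i < n then x i else z (i - n))" for i
    have "Y ` ?J = z ` (\<lambda>i. i - n) ` ?J"
      unfolding image_image by (rule image_cong) (auto simp: Y_def)
    also have "(\<lambda>i. i - n) ` ?J = {..<k}"
      by (simp add: image_minus_const_atLeastLessThan_nat lessThan_atLeast0)
    finally have YJ: "Y ` ?J = f ` A" by (simp add: z)
    have YI: "Y i = x i" if "i \<in> ?I" for i using that by (simp add: Y_def)
    have "Y ` ?I \<subseteq> carrier N" using x(1) YI by auto
    moreover have "Y ` ?J \<subseteq> carrier N" unfolding YJ by (rule fA)
    ultimately have Y: "Y \<in> ?K \<rightarrow> carrier N"
      unfolding image_subset_iff_funcset[symmetric] image_Un by (rule Un_least)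
    then have YIJ: "Y \<in> ?I \<rightarrow> carrier N" "Y \<in> ?J \<rightarrow> carrier N" by auto
    have split: "combination N ?K Y a = combination N ?I Y a \<oplus>\<^bsub>N\<^esub> combination N ?J Y a"
      if "a \<in> ?K \<rightarrow> carrier R" for a
      using Y that by (intro f.N.combination_Un_disjoint) auto
    have combI: "g (combination N ?I Y a) = combination M ?I y a" if "a \<in> ?I \<rightarrow> carrier R" for a
    proof -
      have "g (combination N ?I Y a) = combination M ?I (\<lambda>i. g (Y i)) a"
        using YIJ(1) that by (rule g.hom_combination)
      also have "\<dots> = combination M ?I y a"
        using y x(2) YI that by (intro g.N.combination_cong) auto
      finally show ?thesis .
    qed
    have span_im: "f.N.span (f ` A) = f ` f.M.span A"
      using f.image_span[OF A(2)] by simp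
    have imJ: "combination N ?J Y ` (?J \<rightarrow>\<^sub>E carrier R) = f.N.span (f ` A)"
      using f.N.combination_image[OF _ YIJ(2)] YJ by simp
    interpret FI: module R "R.func_space ?I" by (rule R.func_space_is_module)
    interpret FK: module R "R.func_space ?K" by (rule R.func_space_is_module)
    interpret r: mod_hom R "R.func_space ?K" "R.func_space ?I" "\<lambda>a. restrict a ?I"
      by (rule R.restrict_mod_hom) simp
    interpret y: mod_hom R "R.func_space ?I" M "combination M ?I y"
      using y by (rule g.N.combination_mod_hom)
    interpret Y: mod_hom R "R.func_space ?I" N "combination N ?I Y"
      using YIJ(1) by (rule f.N.combination_mod_hom)
    obtain C t where C: "finite C" "C \<subseteq> relations R N ?K Y" "t \<in> S"
      "\<And>v. v \<in> relations R N ?K Y \<Longrightarrow> t \<odot>\<^bsub>R.func_space ?K\<^esub> v \<in> FK.span C"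
      using f.N.S_coherent_relations[OF S.subset N _ Y]
      unfolding FK.S_finite_submodule_iff[OF f.N.relations_submodule[OF Y]] by auto
    have t: "t \<in> carrier R" using C(3) S.subset by auto
    have CF: "C \<subseteq> carrier (R.func_space ?K)" using C(2) by (auto simp: relations_def)
    \<comment> \<open>Dropping the coefficients on \<open>?J\<close> leaves a relation in
      \<open>M\<close>, because the part over \<open>?J\<close> lies in the image of
      \<open>f\<close> and is killed by \<open>g\<close>.\<close>
    let ?D = "(\<lambda>a. restrict a ?I) ` C"
    have "restrict a ?I \<in> relations R M ?I y" if a: "a \<in> relations R N ?K Y" for a
    proof -
      have aK: "a \<in> ?K \<rightarrow> carrier R" and aE: "a \<in> ?K \<rightarrow>\<^sub>E carrier R"
        and 0: "combination N ?K Y a = \<zero>\<^bsub>N\<^esub>"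
        using a by (auto simp: relations_def)
      have aI: "a \<in> ?I \<rightarrow> carrier R" and aJ: "a \<in> ?J \<rightarrow> carrier R" using aK by auto
      have "combination N ?J Y a = combination N ?J Y (restrict a ?J)"
        using YIJ(2) aJ by (intro f.N.combination_coeff_cong) auto
      also have "\<dots> \<in> f.N.span (f ` A)"
        unfolding imJ[symmetric] using aJ by (intro imageI) auto
      also have "\<dots> \<subseteq> f ` carrier P"
        unfolding span_im using f.M.span_is_subset2[OF A(2)] by (rule image_mono)
      finally have "g (combination N ?J Y a) = \<zero>\<^bsub>M\<^esub>" using exact by auto
      moreover have "g (combination N ?K Y a) = g (combination N ?I Y a) \<oplus>\<^bsub>M\<^esub> g (combination N ?J Y a)"
        unfolding split[OF aK] using YIJ aI aJ by (intro g.f_add f.N.combination_closed)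
      ultimately have "combination M ?I y a = \<zero>\<^bsub>M\<^esub>"
        using 0 combI[OF aI] g.N.combination_closed[OF y aI] by simp
      moreover have "combination M ?I y (restrict a ?I) = combination M ?I y a"
        using y aI by (intro g.N.combination_coeff_cong) auto
      ultimately show ?thesis
        using aI by (auto simp: relations_def)
    qed
    then have D: "?D \<subseteq> relations R M ?I y" using C(2) by auto
    have "(t \<otimes>\<^bsub>R\<^esub> s) \<odot>\<^bsub>R.func_space ?I\<^esub> v \<in> FI.span ?D" if v: "v \<in> relations R M ?I y" for v
    proof -
      have vF: "v \<in> carrier (R.func_space ?I)" using v by (simp add: relations_def)
      have vI: "v \<in> ?I \<rightarrow> carrier R" using v by (auto simp: relations_def)
      let ?c = "combination N ?I Y v"
      have cN: "?c \<in> carrier N" using YIJ(1) vI by (rule f.N.combination_closed)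
      have "g ?c = \<zero>\<^bsub>M\<^esub>" using v combI[OF vI] by (simp add: relations_def)
      then have "?c \<in> f ` carrier P" unfolding exact using cN by simp
      then obtain p where p: "p \<in> carrier P" "?c = f p" by auto
      have "s \<odot>\<^bsub>N\<^esub> ?c = f (s \<odot>\<^bsub>P\<^esub> p)" using p s by simp
      also have "\<dots> \<in> f.N.span (f ` A)" unfolding span_im using A(4)[OF p(1)] by (rule imageI)
      finally have sc: "s \<odot>\<^bsub>N\<^esub> ?c \<in> f.N.span (f ` A)" .
      interpret A: submodule R "f.N.span (f ` A)" N using fA by (rule f.N.span_is_submodule)
      have "\<ominus>\<^bsub>N\<^esub> (s \<odot>\<^bsub>N\<^esub> ?c) \<in> f.N.span (f ` A)"
        using A.smult_closed[OF _ sc, of "\<ominus>\<^bsub>R\<^esub> \<one>\<^bsub>R\<^esub>"] f.N.smult_minus_1[of "s \<odot>\<^bsub>N\<^esub> ?c"] s cN by simp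
      then obtain b where cb: "\<ominus>\<^bsub>N\<^esub> (s \<odot>\<^bsub>N\<^esub> ?c) = combination N ?J Y b"
        and b: "b \<in> ?J \<rightarrow>\<^sub>E carrier R"
        unfolding imJ[symmetric] by (rule imageE)
      define a where "a = (\<lambda>i\<in>?K. if i \<in> ?I then s \<otimes>\<^bsub>R\<^esub> v i else b i)"
      have aK: "a \<in> ?K \<rightarrow>\<^sub>E carrier R"
        using vI b s by (auto simp: a_def Pi_iff PiE_iff)
      have "combination N ?I Y a = combination N ?I Y (s \<odot>\<^bsub>R.func_space ?I\<^esub> v)"
        using YIJ(1) vI s by (intro f.N.combination_coeff_cong) (auto simp: a_def R.smult_func_space Pi_iff)
      also have "\<dots> = s \<odot>\<^bsub>N\<^esub> ?c"
        using s vF by (rule Y.f_smult)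
      finally have 1: "combination N ?I Y a = s \<odot>\<^bsub>N\<^esub> ?c" .
      have "combination N ?J Y a = combination N ?J Y b"
        using YIJ(2) b by (intro f.N.combination_coeff_cong) (auto simp: a_def PiE_iff)
      then have "combination N ?K Y a = \<zero>\<^bsub>N\<^esub>"
        using split[of a] aK 1 cb[symmetric] cN s f.N.M.r_neg[of "s \<odot>\<^bsub>N\<^esub> ?c"] by (auto simp: PiE_iff)
      then have "a \<in> relations R N ?K Y" using aK by (simp add: relations_def)
      \<comment> \<open>The factor \<open>s\<close> made \<open>v\<close> extend to a relation
        \<open>a\<close> of \<open>Y\<close>; now \<open>t\<close> moves \<open>a\<close> into the
        span of \<open>C\<close>, and restricting leaves \<open>t \<otimes> s\<close> times
        \<open>v\<close>.\<close>
      then have "restrict (t \<odot>\<^bsub>R.func_space ?K\<^esub> a) ?I \<in> (\<lambda>a. restrict a ?I) ` FK.span C"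
        by (intro imageI C(4))
      also have "\<dots> = FI.span ?D" using CF by (rule r.image_span)
      also have "restrict (t \<odot>\<^bsub>R.func_space ?K\<^esub> a) ?I = (t \<otimes>\<^bsub>R\<^esub> s) \<odot>\<^bsub>R.func_space ?I\<^esub> v"
        using s t vI by (auto simp: R.smult_func_space a_def fun_eq_iff R.m_assoc Pi_iff)
      finally show ?thesis .
    qed
    then show "S_finite R S (relation_module R M ?I y)"
      unfolding FI.S_finite_submodule_iff[OF g.N.relations_submodule[OF y]]
      using C(1,3) A(3) D S.m_closed by (intro exI[of _ ?D] exI[of _ "t \<otimes>\<^bsub>R\<^esub> s"]) simp
  qed
qed

text \<open>Clear the relations of \<open>g \<circ> y\<close> down to finitely many \<open>l \<in> A\<close>; the combinations of \<open>y\<close> with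
  coefficients \<open>l\<close> come from \<open>P\<close>, where their relations are again \<open>S\<close>-finite.\<close>
lemma S_coherent_extension:
  assumes S: "submonoid S R" and ex: "short_exact R P N M f g"
    and M: "S_coherent R S M" and P: "S_coherent R S P"
  shows "S_coherent R S N"
proof -
  interpret S: submonoid S R by (rule S)
  interpret R: cring R using ex by (simp add: short_exact_iff mod_hom_def module_def)
  interpret f: mod_hom R P N f using ex by (simp add: short_exact_iff)
  interpret g: mod_hom R N M g using ex by (simp add: short_exact_iff)
  have exact: "f ` carrier P = {x \<in> carrier N. g x = \<zero>\<^bsub>M\<^esub>}" and surj: "g ` carrier N = carrier M"
    and inj: "inj_on f (carrier P)"
    using ex by (simp_all add: short_exact_iff)
  show ?thesis
  proof (rule f.N.S_coherentI)
    obtain A where A: "finite A" "A \<subseteq> carrier P" "f.M.span A = carrier P"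
      using P unfolding S_coherent_def finitely_generated_def by blast
    obtain B where B: "finite B" "B \<subseteq> carrier M" "g.N.span B = carrier M"
      using M unfolding S_coherent_def finitely_generated_def by blast
    obtain C where C: "finite C" "C \<subseteq> carrier N" "g ` C = B"
      using finite_subset_image[of B g "carrier N"] B(1,2) surj by auto
    \<comment> \<open>Generators of \<open>P\<close> together with lifts of generators of
      \<open>M\<close>: subtracting a combination \<open>w\<close> of the lifts from
      \<open>x\<close> leaves an element of the kernel of \<open>g\<close>, hence of the image of
      \<open>f\<close>.\<close>
    let ?G = "f ` A \<union> C"
    have G: "?G \<subseteq> carrier N" using A(2) C(2) by auto
    interpret G: submodule R "f.N.span ?G" N using G by (rule f.N.span_is_submodule)
    have "x \<in> f.N.span ?G" if x: "x \<in> carrier N" for x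
    proof -
      have "g x \<in> g ` f.N.span C"
        unfolding g.image_span[OF C(2)] C(3) B(3) using x by simp
      then obtain w where w: "w \<in> f.N.span C" "g x = g w" by auto
      have wN: "w \<in> carrier N" using w(1) f.N.span_is_subset2[OF C(2)] by auto
      have "x \<ominus>\<^bsub>N\<^esub> w \<in> f ` carrier P"
        unfolding exact using x wN w(2) by simp
      then have "x \<ominus>\<^bsub>N\<^esub> w \<in> f.N.span (f ` A)"
        using f.image_span[OF A(2)] A(3) by simp
      then have "x \<ominus>\<^bsub>N\<^esub> w \<in> f.N.span ?G"
        using f.N.span_is_monotone[of "f ` A" ?G] by auto
      moreover have "w \<in> f.N.span ?G"
        using w(1) f.N.span_is_monotone[of C ?G] by auto
      ultimately have "(x \<ominus>\<^bsub>N\<^esub> w) \<oplus>\<^bsub>N\<^esub> w \<in> f.N.span ?G" by (rule G.m_closed)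
      then show ?thesis
        using x wN by (simp add: f.N.M.minus_eq f.N.M.a_assoc f.N.M.l_neg)
    qed
    then have "f.N.span ?G = carrier N" using f.N.span_is_subset2[OF G] by auto
    then show "finitely_generated R N"
      unfolding finitely_generated_def using A(1) C(1) G f.N.module_axioms
      by (intro conjI exI[of _ ?G]) auto
  next
    fix n :: nat and y assume y: "y \<in> {..<n} \<rightarrow> carrier N"
    let ?I = "{..<n}"
    let ?y = "\<lambda>i. g (y i)"
    have gy: "?y \<in> ?I \<rightarrow> carrier M" using y by auto
    interpret FI: module R "R.func_space ?I" by (rule R.func_space_is_module)
    interpret Y: mod_hom R "R.func_space ?I" N "combination N ?I y"
      using y by (rule f.N.combination_mod_hom)
    obtain A s where A: "finite A" "A \<subseteq> relations R M ?I ?y" "s \<in> S"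
      "\<And>v. v \<in> relations R M ?I ?y \<Longrightarrow> s \<odot>\<^bsub>R.func_space ?I\<^esub> v \<in> FI.span A"
      using g.N.S_coherent_relations[OF S.subset M _ gy]
      unfolding FI.S_finite_submodule_iff[OF g.N.relations_submodule[OF gy]] by auto
    have s: "s \<in> carrier R" using A(3) S.subset by auto
    have AF: "A \<subseteq> carrier (R.func_space ?I)" using A(2) by (auto simp: relations_def)
    have gY: "g (combination N ?I y v) = combination M ?I ?y v" if "v \<in> carrier (R.func_space ?I)" for v
      using y that by (intro g.hom_combination) auto
    have "combination N ?I y l \<in> f ` carrier P" if "l \<in> A" for l
    proof -
      have l: "l \<in> carrier (R.func_space ?I)" "l \<in> relations R M ?I ?y" using that AF A(2) by auto
      then have "g (combination N ?I y l) = \<zero>\<^bsub>M\<^esub>" by (simp add: gY relations_def)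
      then show ?thesis unfolding exact using Y.f_im[OF l(1)] by simp
    qed
    then have "combination N ?I y \<in> A \<rightarrow> f ` carrier P" by (rule funcsetI)
    from family_lift[OF this] obtain p
      where "p \<in> A \<rightarrow> carrier P \<and> (\<forall>l\<in>A. f (p l) = combination N ?I y l)" ..
    then have p: "p \<in> A \<rightarrow> carrier P" "\<And>l. l \<in> A \<Longrightarrow> f (p l) = combination N ?I y l"
      by simp_all
    interpret FA: module R "R.func_space A" by (rule R.func_space_is_module)
    have idA: "(\<lambda>l. l) \<in> A \<rightarrow> carrier (R.func_space ?I)" using AF by (intro funcsetI) blast
    \<comment> \<open>The finite set \<open>A\<close> of relations indexes itself, so
      \<open>?c\<close> maps \<open>R^A\<close> to \<open>R^I\<close> and sends the unit vector at
      \<open>l\<close> to \<open>l\<close>. By \<open>Yc\<close> below, composing it with the map of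
      \<open>y\<close> equals \<open>f\<close> after the map of \<open>p\<close>.\<close>
    let ?c = "combination (R.func_space ?I) A (\<lambda>l. l)"
    interpret c: mod_hom R "R.func_space A" "R.func_space ?I" ?c
      using idA by (rule FI.combination_mod_hom)
    have Yc: "combination N ?I y (?c b) = f (combination P A p b)"
      if "b \<in> carrier (R.func_space A)" for b
    proof -
      have b: "b \<in> A \<rightarrow> carrier R" using that by auto
      have "combination N ?I y (?c b) = combination N A (combination N ?I y) b"
        using idA b by (rule Y.hom_combination)
      also have "\<dots> = combination N A (\<lambda>l. f (p l)) b"
        using p b by (intro f.N.combination_cong) auto
      also have "\<dots> = f (combination P A p b)"
        using f.hom_combination[OF p(1) b] by simp
      finally show ?thesis .
    qed
    obtain C t where C: "finite C" "C \<subseteq> relations R P A p" "t \<in> S"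
      "\<And>v. v \<in> relations R P A p \<Longrightarrow> t \<odot>\<^bsub>R.func_space A\<^esub> v \<in> FA.span C"
      using f.M.S_coherent_relations[OF S.subset P A(1) p(1)]
      unfolding FA.S_finite_submodule_iff[OF f.M.relations_submodule[OF p(1)]] by auto
    have t: "t \<in> carrier R" using C(3) S.subset by auto
    have CF: "C \<subseteq> carrier (R.func_space A)" using C(2) by (auto simp: relations_def)
    have "?c b \<in> relations R N ?I y" if "b \<in> C" for b
    proof -
      have b: "b \<in> carrier (R.func_space A)" and 0: "combination P A p b = \<zero>\<^bsub>P\<^esub>"
        using that C(2) by (auto simp: relations_def)
      have "combination N ?I y (?c b) = \<zero>\<^bsub>N\<^esub>" using Yc[OF b] 0 by simp
      then show ?thesis using c.f_im[OF b] by (simp add: relations_def)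
    qed
    then have cC: "?c ` C \<subseteq> relations R N ?I y" by (rule image_subsetI)
    have "(t \<otimes>\<^bsub>R\<^esub> s) \<odot>\<^bsub>R.func_space ?I\<^esub> v \<in> FI.span (?c ` C)" if v: "v \<in> relations R N ?I y" for v
    proof -
      have vF: "v \<in> carrier (R.func_space ?I)" and v0: "combination N ?I y v = \<zero>\<^bsub>N\<^esub>"
        using v by (simp_all add: relations_def)
      let ?sv = "s \<odot>\<^bsub>R.func_space ?I\<^esub> v"
      have "v \<in> relations R M ?I ?y"
        using vF v0 gY[OF vF] by (simp add: relations_def)
      then have "?sv \<in> FI.span A" by (rule A(4))
      also have "FI.span A = ?c ` (A \<rightarrow>\<^sub>E carrier R)"
        using FI.combination_image[OF A(1) idA] by simp
      finally obtain b where cb: "?sv = ?c b" and b: "b \<in> A \<rightarrow>\<^sub>E carrier R"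
        by (rule imageE)
      have bF: "b \<in> carrier (R.func_space A)" using b by simp
      have "combination N ?I y ?sv = \<zero>\<^bsub>N\<^esub>"
        using Y.f_smult[OF s vF] v0 s by simp
      \<comment> \<open>Injectivity of \<open>f\<close> turns the relation \<open>?sv\<close> of
        \<open>y\<close> into a relation \<open>b\<close> of \<open>p\<close>, to which the factor
        \<open>t\<close> applies; \<open>?c\<close> carries the result back to
        \<open>R^I\<close>.\<close>
      then have "f (combination P A p b) = f \<zero>\<^bsub>P\<^esub>"
        unfolding cb using Yc[OF bF] by simp
      then have "combination P A p b = \<zero>\<^bsub>P\<^esub>"
        using b p(1) by (intro inj_onD[OF inj] f.M.combination_closed) auto
      then have "b \<in> relations R P A p" using b by (simp add: relations_def)
      then have "?c (t \<odot>\<^bsub>R.func_space A\<^esub> b) \<in> ?c ` FA.span C" by (intro imageI C(4))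
      also have "\<dots> = FI.span (?c ` C)" using CF by (rule c.image_span)
      also have "?c (t \<odot>\<^bsub>R.func_space A\<^esub> b) = t \<odot>\<^bsub>R.func_space ?I\<^esub> ?sv"
        unfolding cb using t bF by (rule c.f_smult)
      also have "\<dots> = (t \<otimes>\<^bsub>R\<^esub> s) \<odot>\<^bsub>R.func_space ?I\<^esub> v"
        using FI.smult_assoc1[OF t s vF] by simp
      finally show ?thesis .
    qed
    then show "S_finite R S (relation_module R N ?I y)"
      unfolding FI.S_finite_submodule_iff[OF f.N.relations_submodule[OF y]]
      using C(1,3) A(3) cC S.m_closed by (intro exI[of _ "?c ` C"] exI[of _ "t \<otimes>\<^bsub>R\<^esub> s"]) simp
  qed
qed

text \<open>A family in \<open>M\<close> and its image in \<open>N\<close> have literally the same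
  relations, so the same generators and factor serve. Finite generation is assumed because it need
  not pass to submodules.\<close>

lemma (in mod_hom) S_coherent_inj:
  assumes "S \<subseteq> carrier R" and "inj_on f (carrier M)"
    and "finitely_generated R M" and "S_coherent R S N"
  shows "S_coherent R S M"
proof (rule M.S_coherentI)
  fix n :: nat and y assume y: "y \<in> {..<n} \<rightarrow> carrier M"
  then have "(\<lambda>i. f (y i)) \<in> {..<n} \<rightarrow> carrier N" by auto
  from N.S_coherent_relations[OF assms(1,4) _ this]
  show "S_finite R S (relation_module R M {..<n} y)"
    using relations_inj[OF assms(2) y] by simp
qed (fact assms(3))

subsection \<open>Direct sums\<close>

lemma direct_sum_family_simps:
  "finite I \<Longrightarrow> carrier (direct_sum_family I Q) = (\<Pi>\<^sub>E i\<in>I. carrier (Q i))"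
  "\<zero>\<^bsub>direct_sum_family I Q\<^esub> = (\<lambda>i\<in>I. \<zero>\<^bsub>Q i\<^esub>)"
  "x \<oplus>\<^bsub>direct_sum_family I Q\<^esub> y = (\<lambda>i\<in>I. x i \<oplus>\<^bsub>Q i\<^esub> y i)"
  "r \<odot>\<^bsub>direct_sum_family I Q\<^esub> x = (\<lambda>i\<in>I. r \<odot>\<^bsub>Q i\<^esub> x i)"
  by (simp_all add: direct_sum_family_def)

lemma direct_sum_family_module:
  assumes R: "cring R" and fin: "finite I" and Q: "\<And>i. i \<in> I \<Longrightarrow> module R (Q i)"
  shows "module R (direct_sum_family I Q)"
proof (rule moduleI[OF R])
  have ab: "abelian_group (Q i)" if "i \<in> I" for i
    using Q[OF that] by (simp add: module_def)
  show "abelian_group (direct_sum_family I Q)"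
  proof (rule abelian_groupI)
    show "x \<oplus>\<^bsub>direct_sum_family I Q\<^esub> y = y \<oplus>\<^bsub>direct_sum_family I Q\<^esub> x"
      if "x \<in> carrier (direct_sum_family I Q)" "y \<in> carrier (direct_sum_family I Q)" for x y
      using that fin abelian_groupE(4)[OF ab]
      by (auto simp: direct_sum_family_simps fun_eq_iff PiE_iff)
    fix x assume x: "x \<in> carrier (direct_sum_family I Q)"
    show "\<exists>y\<in>carrier (direct_sum_family I Q). y \<oplus>\<^bsub>direct_sum_family I Q\<^esub> x = \<zero>\<^bsub>direct_sum_family I Q\<^esub>"
      using x fin ab by (intro bexI[of _ "\<lambda>i\<in>I. \<ominus>\<^bsub>Q i\<^esub> x i"])
        (auto simp: direct_sum_family_simps abelian_group.l_neg abelian_group.a_inv_closed PiE_iff fun_eq_iff)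
  qed (use fin ab in \<open>auto simp: direct_sum_family_simps PiE_iff
      abelian_groupE(1-3,5) extensional_def fun_eq_iff\<close>)
qed (use fin Q in \<open>auto simp: direct_sum_family_simps PiE_iff fun_eq_iff extensional_def module.smult_closed[OF Q]
    module.smult_l_distr[OF Q] module.smult_r_distr[OF Q] module.smult_assoc1[OF Q] module.smult_one[OF Q]\<close>)

text \<open>Coordinate \<open>i\<close> is split off as the quotient. Members of the smaller sum are
  \<open>undefined\<close> at \<open>i\<close>, so the embedding has to overwrite that value by
  zero.\<close>

lemma direct_sum_family_short_exact:
  assumes R: "cring R" and fin: "finite I" and i: "i \<notin> I"
    and Q: "\<And>j. j \<in> insert i I \<Longrightarrow> module R (Q j)"
  shows "short_exact R (direct_sum_family I Q) (direct_sum_family (insert i I) Q) (Q i)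
    (\<lambda>x. x(i := \<zero>\<^bsub>Q i\<^esub>)) (\<lambda>x. x i)"
proof -
  let ?P = "direct_sum_family I Q" and ?N = "direct_sum_family (insert i I) Q"
  interpret P: module R ?P using R fin Q by (intro direct_sum_family_module) auto
  interpret N: module R ?N using R fin Q by (intro direct_sum_family_module) auto
  interpret Qi: module R "Q i" by (rule Q) simp
  have finI: "finite (insert i I)" using fin by simp
  note simps = direct_sum_family_simps(1)[OF fin] direct_sum_family_simps(1)[OF finI]
    direct_sum_family_simps(2-)
  have "(\<lambda>x. x(i := \<zero>\<^bsub>Q i\<^esub>)) \<in> module_hom R ?P ?N"
    using i by (auto simp: module_hom_def simps fun_eq_iff PiE_iff extensional_def)
  moreover have "(\<lambda>x. x i) \<in> module_hom R ?N (Q i)"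
    by (auto simp: module_hom_def simps)
  moreover have "inj_on (\<lambda>x. x(i := \<zero>\<^bsub>Q i\<^esub>)) (carrier ?P)"
  proof (rule inj_onI)
    fix x y assume xy: "x \<in> carrier ?P" "y \<in> carrier ?P" "x(i := \<zero>\<^bsub>Q i\<^esub>) = y(i := \<zero>\<^bsub>Q i\<^esub>)"
    have "x j = y j" if "j \<in> I" for j
      using fun_cong[OF xy(3), of j] that i by (cases "j = i") auto
    then show "x = y" using xy(1,2) by (intro PiE_ext) (auto simp: simps)
  qed
  moreover have "(\<lambda>x. x(i := \<zero>\<^bsub>Q i\<^esub>)) ` carrier ?P = {x \<in> carrier ?N. x i = \<zero>\<^bsub>Q i\<^esub>}"
  proof (intro equalityI image_subsetI subsetI)
    fix x assume "x \<in> {x \<in> carrier ?N. x i = \<zero>\<^bsub>Q i\<^esub>}"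
    \<comment> \<open>The preimage of \<open>x\<close> resets coordinate \<open>i\<close> from zero
      to \<open>undefined\<close>.\<close>
    then have "restrict x I \<in> carrier ?P" "x = (restrict x I)(i := \<zero>\<^bsub>Q i\<^esub>)"
      by (auto simp: simps fun_eq_iff PiE_iff extensional_def)
    then show "x \<in> (\<lambda>x. x(i := \<zero>\<^bsub>Q i\<^esub>)) ` carrier ?P"
      by (intro image_eqI[of _ _ "restrict x I"])
  qed (auto simp: simps PiE_iff extensional_def)
  moreover have "(\<lambda>x. x i) ` carrier ?N = carrier (Q i)"
  proof (intro equalityI image_subsetI subsetI)
    fix q assume q: "q \<in> carrier (Q i)"
    have "\<zero>\<^bsub>?N\<^esub>(i := q) \<in> carrier ?N"
      using q N.M.zero_closed by (auto simp: simps PiE_iff extensional_def)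
    then show "q \<in> (\<lambda>x. x i) ` carrier ?N" by (rule rev_image_eqI) simp
  qed (auto simp: simps)
  ultimately show ?thesis
    by (simp add: short_exact_iff mod_hom_def mod_hom_axioms_def P.module_axioms N.module_axioms
        Qi.module_axioms)
qed

text \<open>Base case for direct sums. Every coefficient vector is a relation, so the relation
  module is all of \<open>R^n\<close>, generated by the unit vectors with factor
  \<open>\<one>\<close> from \<open>S\<close>.\<close>

lemma (in module) trivial_module_S_coherent:
  assumes S: "submonoid S R" and M: "carrier M = {\<zero>\<^bsub>M\<^esub>}"
  shows "S_coherent R S M"
proof (rule S_coherentI)
  interpret S: submonoid S R by (rule S)
  have "span (carrier M) = carrier M"
    using in_own_span[of "carrier M"] span_is_subset2[of "carrier M"] by simp
  then show "finitely_generated R M"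
    unfolding finitely_generated_def using M module_axioms
    by (intro conjI exI[of _ "carrier M"]) auto
  fix n :: nat and y assume y: "y \<in> {..<n} \<rightarrow> carrier M"
  let ?F = "func_space {..<n}" and ?E = "unit_vector R {..<n} ` {..<n}"
  interpret F: module R ?F by (rule func_space_is_module)
  interpret Y: mod_hom R ?F M "combination M {..<n} y"
    using y by (rule combination_mod_hom)
  have "relations R M {..<n} y = carrier ?F"
    using Y.f_im M by (auto simp: relations_def)
  moreover have "?E \<subseteq> carrier ?F" by (simp add: image_subset_iff)
  moreover have "F.span ?E = carrier ?F" by (rule span_unit_vectors) simp
  ultimately show "S_finite R S (relation_module R M {..<n} y)"
    unfolding F.S_finite_submodule_iff[OF relations_submodule[OF y]]
    using F.smult_one by (intro exI[of _ ?E] exI[of _ \<one>]) (simp del: carrier_func_space)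
qed

lemma S_coherent_direct_sum_family:
  assumes R: "cring R" and S: "submonoid S R"
    and "finite I" and "\<And>i. i \<in> I \<Longrightarrow> S_coherent R S (Q i)"
  shows "S_coherent R S (direct_sum_family I Q)"
  using assms(3,4)
proof (induction I rule: finite_induct)
  case empty
  interpret module R "direct_sum_family {} Q"
    using R by (intro direct_sum_family_module) auto
  show ?case
    using S by (rule trivial_module_S_coherent) (auto simp: direct_sum_family_simps)
next
  case (insert i I)
  have "module R (Q j)" if "j \<in> insert i I" for j
    using insert.prems[OF that] by (simp add: S_coherent_def finitely_generated_def)
  with R insert.hyps have ex: "short_exact R (direct_sum_family I Q) (direct_sum_family (insert i I) Q)
    (Q i) (\<lambda>x. x(i := \<zero>\<^bsub>Q i\<^esub>)) (\<lambda>x. x i)"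
    by (rule direct_sum_family_short_exact)
  have "S_coherent R S (Q i)" using insert.prems by simp
  moreover have "S_coherent R S (direct_sum_family I Q)"
    using insert.prems by (intro insert.IH) simp
  ultimately show ?case by (rule S_coherent_extension[OF S ex])
qed

theorem proposition3p2:
  fixes R :: "('r, 'z) ring_scheme" and S :: "'r set"
    and P :: "('r, 'p, 'x) module_scheme"
    and N :: "('r, 'n, 'y) module_scheme"
    and M :: "('r, 'm, 'w) module_scheme"
    and f :: "'p \<Rightarrow> 'n" and g :: "'n \<Rightarrow> 'm"
  assumes "cring R"
    and "submonoid S R"
    and "short_exact R P N M f g"
  shows "(S_finite R S P \<and> S_coherent R S N \<longrightarrow> S_coherent R S M) \<and>
    ((S_coherent R S M \<and> S_coherent R S P \<longrightarrow> S_coherent R S N) \<and>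
     (\<forall>(I :: 'i set) (Q :: 'i \<Rightarrow> ('r, 'q, 'v) module_scheme).
        finite I \<and> (\<forall>i\<in>I. S_coherent R S (Q i)) \<longrightarrow>
        S_coherent R S (direct_sum_family I Q))) \<and>
    (S_coherent R S N \<and> finitely_generated R P \<longrightarrow> S_coherent R S P)"
proof (intro conjI allI impI)
  show "S_coherent R S M" if "S_finite R S P \<and> S_coherent R S N"
    using S_coherent_quotient[OF assms(2,3)] that by simp
  show "S_coherent R S N" if "S_coherent R S M \<and> S_coherent R S P"
    using S_coherent_extension[OF assms(2,3)] that by simp
  show "S_coherent R S (direct_sum_family I Q)"
    if "finite I \<and> (\<forall>i\<in>I. S_coherent R S (Q i))"
    for I :: "'i set" and Q :: "'i \<Rightarrow> ('r, 'q, 'v) module_scheme"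
    using that by (intro S_coherent_direct_sum_family[OF assms(1,2)]) simp_all
  show "S_coherent R S P" if "S_coherent R S N \<and> finitely_generated R P"
    using mod_hom.S_coherent_inj[of R P N f S] assms(3) submonoid.subset[OF assms(2)] that
    by (simp add: short_exact_iff)
qed

end
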